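(* Let $\alpha$ and $\beta$ be compositions. Then in $\mathrm{QSym}$ $$P_\alpha P_\beta=\sum_{\gamma\in\alpha\mathbin{\sqcup\!\sqcup}\beta}\ \prod_i\frac{m_i(\alpha)!\,m_i(\beta)!}{m_i(\gamma)!}\;P_\gamma ,$$ where $\alpha\mathbin{\sqcup\!\sqcup}\beta$ is the multiset of shuffles of $\alpha$ and $\beta$ (summed with multiplicity).
   Context: A composition is a finite (possibly empty) sequence of positive integers; $\alpha|\beta$ denotes concatenation; $m_i(\alpha)$ is the number of parts of $\alpha$ equal to $i$. The shuffle $\alpha\mathbin{\sqcup\!\sqcup}\beta$ (a multiset) is defined recursively by $\emptyset\mathbin{\sqcup\!\sqcup}\alpha=\alpha\mathbin{\sqcup\!\sqcup}\emptyset=\{\alpha\}$ and, for $\alpha=(a_1,\dots,a_j)$, $\beta=(b_1,\dots,b_k)$ nonempty, $\alpha\mathbin{\sqcup\!\sqcup}\beta=a_1|\big((a_2,\dots,a_j)\mathbin{\sqcup\!\sqcup}\beta\big)+b_1|\big(\alpha\mathbin{\sqcup\!\sqcup}(b_2,\dots,b_k)\big)$, where $+$ is disjoint (multiset) union. For compositions of the same integer, $\alpha\le\beta$ means that $\beta$ is obtained from $\alpha$ by summing groups of consecutive parts (i.e. $\alpha$ refines $\beta$). $\mathrm{QSym}$ is the algebra (over $\mathbb{Q}$) of quasisymmetric functions in $x_1,x_2,\dots$, with monomial basis $M_\alpha=\sum_{i_1<\cdots<i_k}x_{i_1}^{a_1}\cdots x_{i_k}^{a_k}$, $M_\emptyset=1$.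 If $\alpha\le\beta=(b_1,\dots,b_l)$, write uniquely $\alpha=\alpha^{(1)}|\cdots|\alpha^{(l)}$ with $\alpha^{(j)}$ a composition of $b_j$, and put $c_i(\alpha,\beta)!=\prod_{j=1}^l m_i(\alpha^{(j)})!$ and $C_{\alpha\beta}=\prod_{i\ge1}\frac{m_i(\alpha)!}{c_i(\alpha,\beta)!}$. Let $C(\alpha)$ be the composition obtained from $\alpha=(a_1,\dots,a_k)$ by breaking it at every strict ascent $a_i<a_{i+1}$ and replacing each resulting (maximal weakly decreasing) run of consecutive parts by its sum; e.g. $C(3,2,1,1,3,1,1,1,2,1)=(7,6,3)$. The (descending) quasisymmetric powersum function is $$P_\alpha=\sum_{\alpha\le\beta\le C(\alpha)}C_{\alpha\beta}M_\beta ,\qquad P_\emptyset=1.$$ *)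

theory Defs
  imports Complex_Main "HOL-Library.Multiset" "HOL-Library.Groups_Big_Fun"
begin

section \<open>Formal power series in infinitely many variables\<close>

text \<open>
  The variables are indexed by \<open>nat\<close> (only the order of the indices matters). The multiset \<open>m\<close> of
  indices stands for the monomial in which the variable with index \<open>i\<close> has exponent \<open>count m i\<close>.
\<close>

typedef mpser = "UNIV :: (nat multiset \<Rightarrow> rat) set"
  morphisms mcoeff Abs_mpser
  by simp

setup_lifting type_definition_mpser

lemma mpser_eqI: "(\<And>m. mcoeff f m = mcoeff g m) \<Longrightarrow> f = g"
  by (metis ext mcoeff_inject)

lemma finite_decompositions: "finite {(a, b). a + b = (m :: 'a multiset)}"
proof (rule finite_subset)
  let ?S = "mset ` {xs. set xs \<subseteq> set_mset m \<and> length xs \<le> size m}"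
  have "a \<in> ?S" if "a \<subseteq># m" for a
  proof -
    obtain xs where "mset xs = a"
      using ex_mset by blast
    then show ?thesis
      using that set_mset_mono[OF that] size_mset_mono[OF that] by auto
  qed
  then show "{(a, b). a + b = m} \<subseteq> ?S \<times> ?S"
    by auto
qed (simp add: finite_lists_length_le)

instantiation mpser :: comm_ring_1
begin

lift_definition zero_mpser :: mpser is "\<lambda>_. 0" .

lift_definition one_mpser :: mpser is "\<lambda>m. if m = {#} then 1 else 0" .

lift_definition plus_mpser :: "mpser \<Rightarrow> mpser \<Rightarrow> mpser" is "\<lambda>f g m. f m + g m" .

lift_definition minus_mpser :: "mpser \<Rightarrow> mpser \<Rightarrow> mpser" is "\<lambda>f g m. f m - g m" .

lift_definition uminus_mpser :: "mpser \<Rightarrow> mpser" is "\<lambda>f m. - f m" .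

lift_definition times_mpser :: "mpser \<Rightarrow> mpser \<Rightarrow> mpser" is
  "\<lambda>f g m. \<Sum>(a, b) \<in> {(a, b). a + b = m}. f a * g b" .

instance
proof
  fix f g h :: mpser
  show "f * g = g * f"
    by (transfer, rule ext, rule sum.reindex_bij_witness[of _ prod.swap prod.swap])
      (auto simp: add.commute mult.commute)
  show "1 * f = f"
  proof (transfer, rule ext)
    fix f :: "nat multiset \<Rightarrow> rat" and m
    have "(\<Sum>(a, b)\<in>{(a, b). a + b = m}. (if a = {#} then 1 else 0) * f b)
        = (\<Sum>(a, b)\<in>{({#} :: nat multiset, m)}. (if a = {#} then 1 else 0) * f b)"
      by (rule sum.mono_neutral_right[OF finite_decompositions]) (auto split: if_splits)
    then show "(\<Sum>(a, b)\<in>{(a, b). a + b = m}. (if a = {#} then 1 else 0) * f b) = f m"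
      by simp
  qed
  show "(f + g) * h = f * h + g * h"
    by transfer (auto simp: fun_eq_iff algebra_simps sum.distrib[symmetric] intro!: sum.cong)
  show "f * g * h = f * (g * h)"
  proof (transfer, rule ext)
    fix f g h :: "nat multiset \<Rightarrow> rat" and m
    let ?D = "\<lambda>m :: nat multiset. {(a, b). a + b = m}"
    have "(\<Sum>(a, b)\<in>?D m. (\<Sum>(c, d)\<in>?D a. f c * g d) * h b)
        = (\<Sum>((a, b), (c, d))\<in>(SIGMA p : ?D m. ?D (fst p)). f c * g d * h b)"
      by (subst sum.Sigma[symmetric])
        (auto simp: finite_decompositions[unfolded case_prod_unfold]
          sum_distrib_right case_prod_unfold)
    also have "\<dots> = (\<Sum>((a, b), (c, d))\<in>(SIGMA p : ?D m. ?D (snd p)). f a * (g c * h d))"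
      by (rule sum.reindex_bij_witness[of _
            "\<lambda>((a, b), (c, d)). ((a + c, d), (a, c))" "\<lambda>((a, b), (c, d)). ((c, d + b), (d, b))"])
        (auto simp: algebra_simps)
    also have "\<dots> = (\<Sum>(a, b)\<in>?D m. f a * (\<Sum>(c, d)\<in>?D b. g c * h d))"
      by (subst sum.Sigma[symmetric])
        (auto simp: finite_decompositions[unfolded case_prod_unfold]
          sum_distrib_left case_prod_unfold)
    finally show "(\<Sum>(a, b)\<in>?D m. (\<Sum>(c, d)\<in>?D a. f c * g d) * h b)
        = (\<Sum>(a, b)\<in>?D m. f a * (\<Sum>(c, d)\<in>?D b. g c * h d))" .
  qed
  show "0 \<noteq> (1 :: mpser)"
    by transfer (metis zero_neq_one)
qed (transfer; simp add: fun_eq_iff)+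

end

lift_definition scale :: "rat \<Rightarrow> mpser \<Rightarrow> mpser" is "\<lambda>c f m. c * f m" .

lemma scale_one: "scale 1 f = f"
  by (rule mpser_eqI) (simp add: scale.rep_eq)

lemma mcoeff_sum: "mcoeff (sum F A) m = (\<Sum>x\<in>A. mcoeff (F x) m)"
  by (induction A rule: infinite_finite_induct) (auto simp: zero_mpser.rep_eq plus_mpser.rep_eq)


section \<open>Quasisymmetric functions\<close>

text \<open>
  Series of bounded degree whose coefficients do not change when the variables of a monomial are
  replaced, in an order-preserving way, by other variables.
\<close>

definition QSym :: "mpser set" where
  "QSym = {f. (\<exists>d. \<forall>m. mcoeff f m \<noteq> 0 \<longrightarrow> size m \<le> d) \<and>
              (\<forall>m h. strict_mono_on (set_mset m) h \<longrightarrow> mcoeff f (image_mset h m) = mcoeff f m)}"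

lemma QSym_zero: "0 \<in> QSym"
  by (auto simp: QSym_def zero_mpser.rep_eq)

lemma QSym_one: "1 \<in> QSym"
  by (auto simp: QSym_def one_mpser.rep_eq)

lemma QSym_add:
  assumes "f \<in> QSym" "g \<in> QSym"
  shows "f + g \<in> QSym"
proof -
  obtain d e where "\<And>m. mcoeff f m \<noteq> 0 \<Longrightarrow> size m \<le> d" "\<And>m. mcoeff g m \<noteq> 0 \<Longrightarrow> size m \<le> e"
    using assms by (auto simp: QSym_def)
  then have "\<forall>m. mcoeff (f + g) m \<noteq> 0 \<longrightarrow> size m \<le> max d e"
    by (metis add_0 le_max_iff_disj plus_mpser.rep_eq)
  then show ?thesis
    using assms by (auto simp: QSym_def plus_mpser.rep_eq)
qed

lemma QSym_scale: "f \<in> QSym \<Longrightarrow> scale c f \<in> QSym"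
  by (auto simp: QSym_def scale.rep_eq)

lemma QSym_sum: "(\<And>x. x \<in> A \<Longrightarrow> F x \<in> QSym) \<Longrightarrow> sum F A \<in> QSym"
  by (induction A rule: infinite_finite_induct) (auto simp: QSym_zero QSym_add)

lemma image_mset_inj_on:
  "inj_on h (set_mset m) \<Longrightarrow> a \<subseteq># m \<Longrightarrow> b \<subseteq># m \<Longrightarrow> image_mset h a = image_mset h b \<Longrightarrow> a = b"
proof -
  assume inj: "inj_on h (set_mset m)" and ab: "a \<subseteq># m" "b \<subseteq># m"
    and eq: "image_mset h a = image_mset h b"
  have "image_mset (inv_into (set_mset m) h) (image_mset h c) = c" if "c \<subseteq># m" for c
  proof -
    have "image_mset (inv_into (set_mset m) h) (image_mset h c) = image_mset id c"
      unfolding multiset.map_comp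
      by (rule image_mset_cong) (use inj that in \<open>auto dest: mset_subset_eqD\<close>)
    then show ?thesis by simp
  qed
  then show "a = b"
    using ab eq by metis
qed

lemma QSym_mult:
  assumes f: "f \<in> QSym" and g: "g \<in> QSym"
  shows "f * g \<in> QSym"
proof -
  obtain d e where de: "\<And>m. mcoeff f m \<noteq> 0 \<Longrightarrow> size m \<le> d" "\<And>m. mcoeff g m \<noteq> 0 \<Longrightarrow> size m \<le> e"
    using f g by (auto simp: QSym_def)
  have bounded: "size m \<le> d + e" if "mcoeff (f * g) m \<noteq> 0" for m
  proof -
    have "\<exists>p\<in>{(a, b). a + b = m}. (case p of (a, b) \<Rightarrow> mcoeff f a * mcoeff g b) \<noteq> 0"
      using that unfolding times_mpser.rep_eq by (metis (no_types, lifting) sum.neutral)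
    then obtain a b where "a + b = m" "mcoeff f a \<noteq> 0" "mcoeff g b \<noteq> 0"
      by auto
    then show ?thesis
      using de(1)[of a] de(2)[of b] by auto
  qed
  have invariant: "mcoeff (f * g) (image_mset h m) = mcoeff (f * g) m"
    if h: "strict_mono_on (set_mset m) h" for m h
  proof -
    let ?D = "\<lambda>m :: nat multiset. {(a, b). a + b = m}"
    have inj: "inj_on h (set_mset m)"
      using h by (rule strict_mono_on_imp_inj_on)
    have "bij_betw (map_prod (image_mset h) (image_mset h)) (?D m) (?D (image_mset h m))"
      unfolding bij_betw_def
    proof
      show "inj_on (map_prod (image_mset h) (image_mset h)) (?D m)"
      proof (rule inj_onI, clarsimp)
        fix a b a' b' assume m: "m = a + b" "a' + b' = a + b"
          and eq: "image_mset h a = image_mset h a'" "image_mset h b = image_mset h b'"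
        have "a \<subseteq># m" "b \<subseteq># m"
          using m by simp_all
        moreover have "a' \<subseteq># m" "b' \<subseteq># m"
          using m by (metis mset_subset_eq_add_left, metis mset_subset_eq_add_right)
        ultimately show "a = a' \<and> b = b'"
          using image_mset_inj_on[OF inj] eq by blast
      qed
      show "map_prod (image_mset h) (image_mset h) ` ?D m = ?D (image_mset h m)"
        by (auto simp: image_iff) (metis image_mset_eq_plusD)
    qed
    then have "mcoeff (f * g) (image_mset h m)
        = (\<Sum>p\<in>?D m. case map_prod (image_mset h) (image_mset h) p of
              (a, b) \<Rightarrow> mcoeff f a * mcoeff g b)"
      unfolding times_mpser.rep_eq by (rule sum.reindex_bij_betw[symmetric])
    also have "\<dots> = mcoeff (f * g) m"
      unfolding times_mpser.rep_eq
    proof (rule sum.cong[OF refl], clarsimp)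
      fix a b assume "m = a + b"
      then have "strict_mono_on (set_mset a) h" "strict_mono_on (set_mset b) h"
        using h by (auto simp: monotone_on_def)
      then show "mcoeff f (image_mset h a) * mcoeff g (image_mset h b) = mcoeff f a * mcoeff g b"
        using f g by (simp add: QSym_def)
    qed
    finally show ?thesis .
  qed
  show ?thesis
    using bounded invariant by (auto simp: QSym_def)
qed


section \<open>Compositions\<close>

definition composition :: "nat list \<Rightarrow> bool" where
  "composition \<alpha> \<longleftrightarrow> (\<forall>a\<in>set \<alpha>. 0 < a)"

fun shuffle_mset :: "'a list \<Rightarrow> 'a list \<Rightarrow> 'a list multiset" where
  "shuffle_mset [] ys = {#ys#}"
| "shuffle_mset xs [] = {#xs#}"
| "shuffle_mset (x # xs) (y # ys) =
     image_mset ((#) x) (shuffle_mset xs (y # ys)) + image_mset ((#) y) (shuffle_mset (x # xs) ys)"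

text \<open>\<open>grouping \<alpha> \<beta> bs\<close>: \<open>bs\<close> cuts \<open>\<alpha>\<close> into consecutive nonempty groups with sums \<open>\<beta>\<close>.\<close>

definition grouping :: "nat list \<Rightarrow> nat list \<Rightarrow> nat list list \<Rightarrow> bool" where
  "grouping \<alpha> \<beta> bs \<longleftrightarrow> concat bs = \<alpha> \<and> [] \<notin> set bs \<and> map sum_list bs = \<beta>"

definition refines :: "nat list \<Rightarrow> nat list \<Rightarrow> bool" where
  "refines \<alpha> \<beta> \<longleftrightarrow> (\<exists>bs. grouping \<alpha> \<beta> bs)"

definition groups :: "nat list \<Rightarrow> nat list \<Rightarrow> nat list list" where
  "groups \<alpha> \<beta> = (THE bs. grouping \<alpha> \<beta> bs)"

lemma sum_list_prefix_unique:
  fixes xs :: "nat list"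
  assumes "xs @ us = ys @ vs" "sum_list xs = sum_list ys"
    and "\<forall>a\<in>set (xs @ us). 0 < a"
  shows "xs = ys \<and> us = vs"
  using assms
proof (induction xs arbitrary: ys)
  case Nil
  then show ?case by (cases ys) auto
next
  case (Cons x xs)
  then show ?case by (cases ys) auto
qed

lemma grouping_unique:
  assumes "composition \<alpha>" "grouping \<alpha> \<beta> bs" "grouping \<alpha> \<beta> cs"
  shows "bs = cs"
  using assms
proof (induction bs arbitrary: \<alpha> \<beta> cs)
  case Nil
  then show ?case by (auto simp: grouping_def)
next
  case (Cons b bs)
  then obtain c cs' where cs: "cs = c # cs'"
    by (cases cs) (auto simp: grouping_def)
  have "b = c \<and> concat bs = concat cs'"
    using Cons.prems cs
    by (intro sum_list_prefix_unique) (auto simp: grouping_def composition_def)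
  moreover from this have "bs = cs'"
    using Cons.prems cs
    by (intro Cons.IH[of "concat bs" "map sum_list bs"]) (auto simp: grouping_def composition_def)
  ultimately show ?case
    using cs by simp
qed

lemma groups_eqI: "composition \<alpha> \<Longrightarrow> grouping \<alpha> \<beta> bs \<Longrightarrow> groups \<alpha> \<beta> = bs"
  unfolding groups_def by (blast intro: the_equality grouping_unique)

lemma grouping_groups: "composition \<alpha> \<Longrightarrow> refines \<alpha> \<beta> \<Longrightarrow> grouping \<alpha> \<beta> (groups \<alpha> \<beta>)"
  unfolding refines_def using groups_eqI by blast

lemma refines_composition: "composition \<alpha> \<Longrightarrow> refines \<alpha> \<beta> \<Longrightarrow> composition \<beta>"
proof -
  assume "composition \<alpha>" "refines \<alpha> \<beta>"
  then obtain bs where bs: "composition (concat bs)" "[] \<notin> set bs" "\<beta> = map sum_list bs"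
    by (auto simp: refines_def grouping_def)
  have "0 < sum_list b" if "b \<in> set bs" for b
  proof (cases b)
    case (Cons a as)
    then have "0 < a"
      using bs that by (auto simp: composition_def)
    then show ?thesis
      by (simp add: Cons)
  qed (use bs that in auto)
  then show "composition \<beta>"
    by (auto simp: bs composition_def)
qed

lemma refines_sum_list:
  assumes "refines \<alpha> \<beta>"
  shows "sum_list \<beta> = sum_list \<alpha>"
proof -
  have "sum_list (concat bs) = sum_list (map sum_list bs)" for bs :: "nat list list"
    by (induction bs) auto
  then show ?thesis
    using assms by (auto simp: refines_def grouping_def)
qed

lemma length_le_length_concat: "[] \<notin> set bs \<Longrightarrow> length bs \<le> length (concat bs)"
proof (induction bs)
  case (Cons b bs)
  then show ?case by (cases b) auto
qed simp

lemma finite_coarsenings: "finite {\<beta>. refines \<alpha> \<beta>}"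
proof (rule finite_subset)
  show "{\<beta>. refines \<alpha> \<beta>} \<subseteq> {\<beta>. set \<beta> \<subseteq> {..sum_list \<alpha>} \<and> length \<beta> \<le> length \<alpha>}"
  proof safe
    fix \<beta> b assume \<beta>: "refines \<alpha> \<beta>"
    show "length \<beta> \<le> length \<alpha>"
      using \<beta> by (auto simp: refines_def grouping_def intro: length_le_length_concat)
    assume "b \<in> set \<beta>"
    then show "b \<le> sum_list \<alpha>"
      using refines_sum_list[OF \<beta>] by (metis member_le_sum_list zero_le)
  qed
qed (simp add: finite_lists_length_le)

fun descending_runs :: "nat list \<Rightarrow> nat list list" where
  "descending_runs [] = []"
| "descending_runs [a] = [[a]]"
| "descending_runs (a # b # as) =
     (let rs = descending_runs (b # as)
      in if a < b then [a] # rs else (a # hd rs) # tl rs)"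

definition C_comp :: "nat list \<Rightarrow> nat list" where
  "C_comp \<alpha> = map sum_list (descending_runs \<alpha>)"

lemma "C_comp [3, 2, 1, 1, 3, 1, 1, 1, 2, 1] = [7, 6, 3]"
  by (simp add: C_comp_def)


section \<open>Monomial quasisymmetric functions and quasisymmetric powersums\<close>

text \<open>The monomial with exponents \<open>\<alpha>\<close> on the variables with indices \<open>is\<close>.\<close>

definition monomial :: "nat list \<Rightarrow> nat list \<Rightarrow> nat multiset" where
  "monomial is \<alpha> = sum_list (map2 replicate_mset \<alpha> is)"

text \<open>
  As the exponents of a composition are positive, a monomial determines the index sequence \<open>is\<close>, so
  that each monomial occurs at most once in the sum defining the monomial quasisymmetric function.
\<close>

lift_definition M :: "nat list \<Rightarrow> mpser" is
  "\<lambda>\<alpha> m. if \<exists>is. sorted_wrt (<) is \<and> length is = length \<alpha> \<and> m = monomial is \<alpha> then 1 else 0" .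

lemma set_mset_monomial:
  "length is = length \<alpha> \<Longrightarrow> composition \<alpha> \<Longrightarrow> set_mset (monomial is \<alpha>) = set is"
  by (induction "is" \<alpha> rule: list_induct2) (auto simp: monomial_def composition_def)

lemma monomial_inj:
  assumes "composition \<alpha>" "length is = length \<alpha>" "length js = length \<alpha>"
    and "sorted_wrt (<) is" "sorted_wrt (<) js" "monomial is \<alpha> = monomial js \<alpha>"
  shows "is = js"
  using assms by (metis set_mset_monomial strict_sorted_equal)

lemma image_monomial:
  "length is = length \<alpha> \<Longrightarrow> image_mset h (monomial is \<alpha>) = monomial (map h is) \<alpha>"
  by (induction "is" \<alpha> rule: list_induct2) (auto simp: monomial_def)

lemma size_monomial: "length is = length \<alpha> \<Longrightarrow> size (monomial is \<alpha>) = sum_list \<alpha>"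
  by (induction "is" \<alpha> rule: list_induct2) (auto simp: monomial_def)

lemma M_Nil: "M [] = 1"
  by (rule mpser_eqI) (auto simp: M.rep_eq one_mpser.rep_eq monomial_def)

lemma M_in_QSym:
  assumes \<alpha>: "composition \<alpha>"
  shows "M \<alpha> \<in> QSym"
proof -
  define occurs where
    "occurs m \<longleftrightarrow> (\<exists>is. sorted_wrt (<) is \<and> length is = length \<alpha> \<and> m = monomial is \<alpha>)" for m
  have M: "mcoeff (M \<alpha>) m = (if occurs m then 1 else 0)" for m
    by (simp add: M.rep_eq occurs_def)
  have image: "occurs (image_mset h m)" if "occurs m" and h: "strict_mono_on (set_mset m) h" for m h
  proof -
    obtain "is" where "is": "sorted_wrt (<) is" "length is = length \<alpha>" "m = monomial is \<alpha>"
      using \<open>occurs m\<close> by (auto simp: occurs_def)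
    then have "sorted_wrt (<) (map h is)"
      using h set_mset_monomial[OF "is"(2) \<alpha>]
      by (auto simp: sorted_wrt_map monotone_on_def intro: sorted_wrt_mono_rel[of "is" "(<)"])
    then show ?thesis
      using "is" unfolding occurs_def by (intro exI[of _ "map h is"]) (simp add: image_monomial)
  qed
  have "occurs (image_mset h m) \<longleftrightarrow> occurs m" if h: "strict_mono_on (set_mset m) h" for m h
  proof
    assume *: "occurs (image_mset h m)"
    let ?h' = "inv_into (set_mset m) h"
    have inj: "inj_on h (set_mset m)"
      using h by (rule strict_mono_on_imp_inj_on)
    have "strict_mono_on (set_mset (image_mset h m)) ?h'"
    proof (rule monotone_onI)
      fix x y assume "x \<in> set_mset (image_mset h m)" "y \<in> set_mset (image_mset h m)" "x < y"
      then obtain i j where "i \<in># m" "j \<in># m" "x = h i" "y = h j" "h i < h j"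
        by auto
      then show "?h' x < ?h' y"
        using inj h by (metis inv_into_f_f linorder_cases monotone_onD order_less_asym)
    qed
    with * have "occurs (image_mset ?h' (image_mset h m))"
      by (rule image)
    moreover have "image_mset ?h' (image_mset h m) = image_mset id m"
      unfolding multiset.map_comp by (rule image_mset_cong) (use inj in auto)
    ultimately show "occurs m"
      by simp
  qed (use image h in blast)
  moreover have "\<forall>m. occurs m \<longrightarrow> size m \<le> sum_list \<alpha>"
    by (auto simp: occurs_def size_monomial)
  ultimately show ?thesis
    unfolding QSym_def by (simp add: M) blast
qed

text \<open>
  The unrestricted product over \<open>i\<close> is the product over the finitely many factors different from 1.
  For a composition, \<open>i = 0\<close> contributes the factor 1.
\<close>

definition C_coeff :: "nat list \<Rightarrow> nat list \<Rightarrow> rat" where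
  "C_coeff \<alpha> \<beta> =
     (\<Prod>i. fact (count_list \<alpha> i) / (\<Prod>\<alpha>'\<leftarrow>groups \<alpha> \<beta>. fact (count_list \<alpha>' i)))"

definition P :: "nat list \<Rightarrow> mpser" where
  "P \<alpha> = (\<Sum>\<beta> | refines \<alpha> \<beta> \<and> refines \<beta> (C_comp \<alpha>). scale (C_coeff \<alpha> \<beta>) (M \<beta>))"

lemma P_in_QSym: "composition \<alpha> \<Longrightarrow> P \<alpha> \<in> QSym"
  unfolding P_def by (intro QSym_sum QSym_scale M_in_QSym) (auto intro: refines_composition)

lemma P_Nil: "P [] = 1"
proof -
  have "groups [] [] = []"
    by (rule groups_eqI) (auto simp: composition_def grouping_def)
  then have "C_coeff [] [] = 1"
    by (simp add: C_coeff_def)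
  moreover have "refines [] \<beta> \<longleftrightarrow> \<beta> = []" for \<beta>
  proof
    assume "refines [] \<beta>"
    then obtain bs where "concat bs = []" "[] \<notin> set bs" "\<beta> = map sum_list bs"
      by (auto simp: refines_def grouping_def)
    then show "\<beta> = []"
      by (cases bs) auto
  qed (auto simp: refines_def grouping_def)
  then have "{\<beta>. refines [] \<beta> \<and> refines \<beta> (C_comp [])} = {[]}"
    by (auto simp: C_comp_def)
  ultimately show ?thesis
    by (simp add: P_def M_Nil scale_one)
qed

end

theory Submission
  imports Defs
begin

text \<open>
  Put \<open>p\<^sub>\<alpha> = P\<^sub>\<alpha> / \<Prod>\<^sub>i m\<^sub>i(\<alpha>)!\<close>. The claim is that \<open>\<alpha> \<mapsto> p\<^sub>\<alpha>\<close> turns shuffles into products,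
  i.e. is a character of the shuffle algebra. The compositions between \<open>\<alpha>\<close> and \<open>C(\<alpha>)\<close> correspond
  to the cuts of \<open>\<alpha>\<close> into nonempty weakly decreasing blocks, and \<open>C\<^sub>\<alpha>\<^sub>\<beta> / \<Prod>\<^sub>i m\<^sub>i(\<alpha>)!\<close> is the product
  over the blocks \<open>b\<close> of \<open>1 / \<Prod>\<^sub>i m\<^sub>i(b)!\<close>. Hence, in finitely many variables \<open>x\<^sub>1 < \<dots> < x\<^sub>n\<close>, \<open>p\<close> is the
  convolution (with respect to deconcatenation) of the functions sending a weakly decreasing word \<open>w\<close>
  to \<open>x\<^sub>j\<close> to the power \<open>|w|\<close> divided by \<open>\<Prod>\<^sub>i m\<^sub>i(w)!\<close>, and every other word to 0. Each of these is a character, and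
  characters are closed under convolution. Finitely many variables suffice to compare the
  coefficients of a given monomial.
\<close>

section \<open>Characters of the shuffle algebra and their convolution\<close>

lemma shuffle_mset_Nil_right [simp]: "shuffle_mset xs [] = {#xs#}"
  by (cases xs) auto

lemma mset_shuffle: "zs \<in># shuffle_mset xs ys \<Longrightarrow> mset zs = mset xs + mset ys"
  by (induction xs ys arbitrary: zs rule: shuffle_mset.induct) auto

definition shuffle_character :: "('a list \<Rightarrow> 'b::comm_semiring_1) \<Rightarrow> bool" where
  "shuffle_character f \<longleftrightarrow> (\<forall>u v. f u * f v = (\<Sum>w\<in>#shuffle_mset u v. f w))"

text \<open>An arbitrary \<open>F\<close> in place of a product \<open>f u * g v\<close> keeps the
  recursion on the word within the same notion: peeling off the first letter \<open>a\<close> turns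
  \<open>F\<close> into \<open>\<lambda>u. F (a # u)\<close>.\<close>

definition deconc_sum :: "('a list \<Rightarrow> 'a list \<Rightarrow> 'b::comm_monoid_add) \<Rightarrow> 'a list \<Rightarrow> 'b" where
  "deconc_sum F w = (\<Sum>i\<le>length w. F (take i w) (drop i w))"

lemma deconc_sum_Nil [simp]: "deconc_sum F [] = F [] []"
  by (simp add: deconc_sum_def)

lemma deconc_sum_Cons: "deconc_sum F (a # w) = F [] (a # w) + deconc_sum (\<lambda>u. F (a # u)) w"
  by (simp add: deconc_sum_def sum.atMost_Suc_shift del: sum.atMost_Suc)

lemma deconc_sum_add: "deconc_sum (\<lambda>u v. F u v + G u v) w = deconc_sum F w + deconc_sum G w"
  by (simp add: deconc_sum_def sum.distrib)

text \<open>Deconcatenation is a homomorphism for the shuffle product.\<close>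

lemma deconc_sum_shuffle:
  "(\<Sum>w\<in>#shuffle_mset xs ys. deconc_sum F w) =
     deconc_sum (\<lambda>x x'. deconc_sum (\<lambda>y y'.
       \<Sum>u\<in>#shuffle_mset x y. \<Sum>v\<in>#shuffle_mset x' y'. F u v) ys) xs"
proof (induction xs ys arbitrary: F rule: shuffle_mset.induct)
  case (3 a xs b ys)
  show ?case
    by (simp add: deconc_sum_Cons sum_mset.distrib image_mset.compositionality comp_def 3
        deconc_sum_add add_ac)
qed simp_all

text \<open>By \<open>deconc_sum_shuffle\<close>, the sum over shuffles splits into independent sums
  over shuffles of the prefixes and of the suffixes. The two characters evaluate these, and
  commutativity regroups the factors.\<close>

lemma shuffle_character_conv:
  assumes "shuffle_character f" "shuffle_character g"
  shows "shuffle_character (deconc_sum (\<lambda>u v. f u * g v))"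
  unfolding shuffle_character_def
proof (intro allI)
  fix xs ys
  have *: "(\<Sum>u\<in>#shuffle_mset x y. \<Sum>v\<in>#shuffle_mset x' y'. f u * g v) = (f x * g x') * (f y * g y')"
    for x y x' y'
  proof -
    have "(\<Sum>u\<in>#shuffle_mset x y. \<Sum>v\<in>#shuffle_mset x' y'. f u * g v)
        = (\<Sum>u\<in>#shuffle_mset x y. f u) * (\<Sum>v\<in>#shuffle_mset x' y'. g v)"
      by (simp add: sum_mset_distrib_left[symmetric] sum_mset_distrib_right[symmetric])
    then show ?thesis
      using assms unfolding shuffle_character_def by (metis mult.assoc mult.left_commute)
  qed
  show "deconc_sum (\<lambda>u v. f u * g v) xs * deconc_sum (\<lambda>u v. f u * g v) ys
      = (\<Sum>w\<in>#shuffle_mset xs ys. deconc_sum (\<lambda>u v. f u * g v) w)"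
    unfolding deconc_sum_shuffle * by (simp add: deconc_sum_def sum_product)
qed

text \<open>The neutral element of convolution, which is the character belonging to no variables at
  all.\<close>

lemma shuffle_character_counit: "shuffle_character (\<lambda>w. if w = [] then 1 else 0)"
  unfolding shuffle_character_def
proof (intro allI)
  fix u v :: "'a list"
  show "(if u = [] then 1 else 0) * (if v = [] then 1 else 0)
      = (\<Sum>w\<in>#shuffle_mset u v. if w = [] then 1 else 0 :: 'b)"
    by (induction u v rule: shuffle_mset.induct)
      (simp_all add: image_mset.compositionality comp_def)
qed

section \<open>The weight of weakly decreasing words\<close>

definition mult_fact :: "nat list \<Rightarrow> rat" where
  "mult_fact w = (\<Prod>i. fact (count_list w i))"

lemma count_list_eq_0: "i \<notin> set w \<Longrightarrow> count_list w i = 0"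
  by (simp add: count_list_0_iff)

lemma mult_fact_superset:
  assumes "finite A" "set w \<subseteq> A"
  shows "mult_fact w = (\<Prod>i\<in>A. fact (count_list w i))"
  unfolding mult_fact_def
  by (rule Prod_any.expand_superset) (use assms count_list_eq_0 in \<open>fastforce+\<close>)

lemma mult_fact_neq_0 [simp]: "mult_fact w \<noteq> 0"
  by (simp add: mult_fact_superset[OF _ order.refl])

lemma mult_fact_Nil [simp]: "mult_fact [] = 1"
  by (simp add: mult_fact_def)

lemma mult_fact_Cons: "mult_fact (a # w) = of_nat (count_list w a + 1) * mult_fact w"
proof -
  let ?A = "insert a (set w)"
  have "mult_fact (a # w) = fact (count_list w a + 1) * (\<Prod>i\<in>?A - {a}. fact (count_list w i))"
    by (subst mult_fact_superset[of ?A])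
      (auto simp: prod.remove[of ?A a] intro!: prod.cong)
  moreover have "mult_fact w = fact (count_list w a) * (\<Prod>i\<in>?A - {a}. fact (count_list w i))"
    by (subst mult_fact_superset[of ?A]) (auto simp: prod.remove[of ?A a])
  ultimately show ?thesis
    by (simp add: fact_Suc algebra_simps del: of_nat_Suc)
qed

definition desc_weight :: "nat list \<Rightarrow> rat" where
  "desc_weight w = (if sorted_wrt (\<ge>) w then 1 / mult_fact w else 0)"

lemma desc_weight_Nil [simp]: "desc_weight [] = 1"
  by (simp add: desc_weight_def)

lemma desc_weight_Cons:
  "desc_weight (a # w) =
     (if \<forall>c\<in>set w. c \<le> a then desc_weight w / of_nat (count_list w a + 1) else 0)"
  by (auto simp: desc_weight_def mult_fact_Cons)

text \<open>All shuffles of \<open>u\<close> and \<open>v\<close> have the same letters with the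
  same multiplicities, so the factor due to the new first letter \<open>a\<close> is constant and
  leaves the sum.\<close>

lemma sum_mset_desc_weight_Cons:
  "(\<Sum>w\<in>#shuffle_mset u v. desc_weight (a # w)) =
     (if \<forall>c\<in>set u \<union> set v. c \<le> a
      then (\<Sum>w\<in>#shuffle_mset u v. desc_weight w) / of_nat (count_list u a + count_list v a + 1)
      else 0)"
proof -
  have w: "set w = set u \<union> set v" "count_list w a = count_list u a + count_list v a"
    if "w \<in># shuffle_mset u v" for w
    using mset_shuffle[OF that]
    by (metis set_mset_mset set_mset_union, metis count_mset count_union)
  have "(\<Sum>w\<in>#shuffle_mset u v. desc_weight (a # w)) =
    (\<Sum>w\<in>#shuffle_mset u v. (if \<forall>c\<in>set u \<union> set v. c \<le> a
      then 1 / of_nat (count_list u a + count_list v a + 1) else 0) * desc_weight w)"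
    by (rule arg_cong[of _ _ sum_mset], rule image_mset_cong) (simp add: desc_weight_Cons w)
  then show ?thesis
    by (simp add: sum_mset_distrib_left[symmetric])
qed

text \<open>For weakly decreasing \<open>u\<close> and \<open>v\<close>, the only weakly decreasing
  shuffle is their sorted merge. It occurs once for each way to interleave equal letters, a product
  of binomial coefficients, which is the ratio of the weights. The induction checks this by first
  letters: the larger one must come first, and equal ones give two contributions.\<close>

lemma shuffle_character_desc_weight: "shuffle_character desc_weight"
  unfolding shuffle_character_def
proof (intro allI)
  fix u v
  show "desc_weight u * desc_weight v = (\<Sum>w\<in>#shuffle_mset u v. desc_weight w)"
  proof (induction u v rule: shuffle_mset.induct)
    case (3 a u b v)
    \<comment> \<open>If the first letters differ, the larger one is absent from the word starting
      with the smaller one, provided that word is weakly decreasing; so the denominator counts it in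
      one word only.\<close>
    have not_in: "count_list w c = 0" if "\<forall>d\<in>set w. d \<le> e" "e < c" for w :: "nat list" and c e
      using that by (force intro: count_list_eq_0)
    have "(\<Sum>w\<in>#shuffle_mset (a # u) (b # v). desc_weight w)
       = (\<Sum>w\<in>#shuffle_mset u (b # v). desc_weight (a # w))
         + (\<Sum>w\<in>#shuffle_mset (a # u) v. desc_weight (b # w))"
      by (simp add: image_mset.compositionality comp_def)
    also have "\<dots> =
        (if \<forall>c\<in>set u \<union> set (b # v). c \<le> a then desc_weight u * desc_weight (b # v) /
           of_nat (count_list u a + count_list (b # v) a + 1) else 0)
      + (if \<forall>c\<in>set (a # u) \<union> set v. c \<le> b then desc_weight (a # u) * desc_weight v /
           of_nat (count_list (a # u) b + count_list v b + 1) else 0)"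
      by (simp only: sum_mset_desc_weight_Cons 3)
    also have "\<dots> = desc_weight (a # u) * desc_weight (b # v)"
    proof (cases a b rule: linorder_cases)
      case equal
      \<comment> \<open>These count the copies of the common first letter in the two tails. The
        contributions add up by 1/((l+1)(k+l+2)) + 1/((k+1)(k+l+2)) = 1/((k+1)(l+1)).\<close>
      define k l where k_def: "k = (of_nat (count_list u b) :: rat)"
        and l_def: "l = (of_nat (count_list v b) :: rat)"
      then have "k \<ge> 0" "l \<ge> 0"
        by simp_all
      then have "x * (y / (l + 1)) / (k + l + 2) + x / (k + 1) * y / (k + l + 2)
          = x / (k + 1) * (y / (l + 1))" for x y :: rat
        by (simp add: divide_simps) (simp add: algebra_simps)
      then show ?thesis
        using equal by (simp add: desc_weight_Cons ball_Un k_def[symmetric] l_def[symmetric] add_ac)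
    next
      case less
      then show ?thesis
        by (auto simp: desc_weight_Cons[of a] desc_weight_Cons[of b] not_in)
    next
      case greater
      then show ?thesis
        by (auto simp: desc_weight_Cons[of a] desc_weight_Cons[of b] not_in)
    qed
    finally show ?case by simp
  qed simp_all
qed

section \<open>Scalar multiples of power series\<close>

lemma mcoeff_scale: "mcoeff (scale c f) m = c * mcoeff f m"
  by (simp add: scale.rep_eq)

lemma scale_scale: "scale a (scale b f) = scale (a * b) f"
  by (rule mpser_eqI) (simp add: mcoeff_scale)

lemma scale_zero_left [simp]: "scale 0 f = 0"
  by (rule mpser_eqI) (simp add: mcoeff_scale zero_mpser.rep_eq)

lemma scale_zero_right [simp]: "scale c 0 = 0"
  by (rule mpser_eqI) (simp add: mcoeff_scale zero_mpser.rep_eq)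

lemma scale_add_left: "scale (a + b) f = scale a f + scale b f"
  by (rule mpser_eqI) (simp add: mcoeff_scale plus_mpser.rep_eq algebra_simps)

lemma scale_add_right: "scale c (f + g) = scale c f + scale c g"
  by (rule mpser_eqI) (simp add: mcoeff_scale plus_mpser.rep_eq algebra_simps)

lemma scale_sum: "scale c (sum F A) = (\<Sum>x\<in>A. scale c (F x))"
  by (induction A rule: infinite_finite_induct) (simp_all add: scale_add_right)

lemma scale_sum_mset: "scale c (\<Sum>x\<in>#A. F x) = (\<Sum>x\<in>#A. scale c (F x))"
  by (induction A) (simp_all add: scale_add_right)

lemma sum_mset_scale: "(\<Sum>x\<in>#A. scale (c x) f) = scale (\<Sum>x\<in>#A. c x) f"
  by (induction A) (simp_all add: scale_add_left)

lemma scale_times_scale: "scale a f * scale b g = scale (a * b) (f * g)"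
  by (rule mpser_eqI)
    (simp add: mcoeff_scale times_mpser.rep_eq sum_distrib_left case_prod_unfold mult_ac)

lemma mcoeff_sum_mset: "mcoeff (\<Sum>x\<in>#A. F x) m = (\<Sum>x\<in>#A. mcoeff (F x) m)"
  by (induction A) (simp_all add: zero_mpser.rep_eq plus_mpser.rep_eq)

section \<open>Monomial quasisymmetric functions in finitely many variables\<close>

lift_definition monom_ser :: "nat multiset \<Rightarrow> mpser" is "\<lambda>k m. if m = k then 1 else 0" .

lemma mcoeff_monom_ser_mult:
  "mcoeff (monom_ser k * f) m = (if k \<subseteq># m then mcoeff f (m - k) else 0)"
proof -
  have "mcoeff (monom_ser k * f) m = (\<Sum>p\<in>{(a, b). a + b = m}.
      if p = (k, m - k) then mcoeff f (m - k) else 0)"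
    unfolding times_mpser.rep_eq by (rule sum.cong) (auto simp: monom_ser.rep_eq split: if_splits)
  then show ?thesis
    by (auto simp: finite_decompositions sum.delta subset_mset.add_diff_inverse)
      (metis mset_subset_eq_add_left)
qed

lemma monom_ser_empty [simp]: "monom_ser {#} = 1"
  by (rule mpser_eqI) (simp add: monom_ser.rep_eq one_mpser.rep_eq)

lemma monom_ser_add: "monom_ser (k + l) = monom_ser k * monom_ser l"
proof (rule mpser_eqI)
  fix m :: "nat multiset"
  show "mcoeff (monom_ser (k + l)) m = mcoeff (monom_ser k * monom_ser l) m"
    by (auto simp: mcoeff_monom_ser_mult monom_ser.rep_eq)
qed

text \<open>For increasing \<open>xs\<close> this is \<open>M \<beta>\<close> with all variables
  outside \<open>xs\<close> set to 0. The recursion asks whether the smallest variable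
  \<open>x\<close> carries the first part \<open>b\<close> or does not occur.\<close>

fun M_in :: "nat list \<Rightarrow> nat list \<Rightarrow> mpser" where
  "M_in xs [] = 1"
| "M_in [] (b # \<beta>) = 0"
| "M_in (x # xs) (b # \<beta>) = M_in xs (b # \<beta>) + monom_ser (replicate_mset b x) * M_in xs \<beta>"

text \<open>Coefficients stay 0 or 1 because the two summands of the recursion share no monomial:
  \<open>x\<close> divides every monomial of the second, as \<open>b\<close> is positive, and none
  of the first, as \<open>x\<close> is smaller than all of \<open>xs\<close>.\<close>

lemma mcoeff_M_in:
  assumes "sorted_wrt (<) xs" "composition \<beta>"
  shows "mcoeff (M_in xs \<beta>) m =
    (if \<exists>is. sorted_wrt (<) is \<and> length is = length \<beta> \<and> m = monomial is \<beta> \<and> set is \<subseteq> set xs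
     then 1 else 0)"
  using assms
proof (induction xs \<beta> arbitrary: m rule: M_in.induct)
  case (1 xs)
  have "(\<exists>is. sorted_wrt (<) is \<and> is = [] \<and> m = monomial is [] \<and> set is \<subseteq> set xs) \<longleftrightarrow> m = {#}"
    by (auto simp: monomial_def)
  then show ?case
    by (simp add: one_mpser.rep_eq)
next
  case (2 b \<beta>)
  then show ?case
    by (simp add: zero_mpser.rep_eq)
next
  case (3 x xs b \<beta>)
  define occ where "occ ys \<gamma> m \<longleftrightarrow>
    (\<exists>is. sorted_wrt (<) is \<and> length is = length \<gamma> \<and> m = monomial is \<gamma> \<and> set is \<subseteq> set ys)"
    for ys \<gamma> m
  let ?r = "replicate_mset b x"
  have x: "\<forall>y\<in>set xs. x < y" and b: "0 < b" and \<beta>: "composition \<beta>"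
    using "3.prems" by (auto simp: composition_def)
  have mon: "monomial (x # is) (b # \<beta>) = ?r + monomial is \<beta>" for "is"
    by (simp add: monomial_def)
  have occ_iff: "occ (x # xs) (b # \<beta>) m \<longleftrightarrow> occ xs (b # \<beta>) m \<or> ?r \<subseteq># m \<and> occ xs \<beta> (m - ?r)"
  proof
    assume "occ (x # xs) (b # \<beta>) m"
    then obtain i "is" where "is": "sorted_wrt (<) (i # is)" "length is = length \<beta>"
      "m = monomial (i # is) (b # \<beta>)" "set (i # is) \<subseteq> set (x # xs)"
      unfolding occ_def by (metis length_Suc_conv length_Cons)
    show "occ xs (b # \<beta>) m \<or> ?r \<subseteq># m \<and> occ xs \<beta> (m - ?r)"
    proof (cases "i = x")
      case True
      then have "?r \<subseteq># m \<and> occ xs \<beta> (m - ?r)"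
        using "is" unfolding occ_def mon by (auto simp: mon)
      then show ?thesis ..
    next
      case False
      then have "set (i # is) \<subseteq> set xs"
        using "is" x by force
      then have "occ xs (b # \<beta>) m"
        using "is" unfolding occ_def by (intro exI[of _ "i # is"]) simp
      then show ?thesis ..
    qed
  next
    assume "occ xs (b # \<beta>) m \<or> ?r \<subseteq># m \<and> occ xs \<beta> (m - ?r)"
    then show "occ (x # xs) (b # \<beta>) m"
    proof
      assume "occ xs (b # \<beta>) m"
      then show ?thesis
        unfolding occ_def by fastforce
    next
      assume *: "?r \<subseteq># m \<and> occ xs \<beta> (m - ?r)"
      then obtain "is" where "is": "sorted_wrt (<) is" "length is = length \<beta>"
        "m - ?r = monomial is \<beta>" "set is \<subseteq> set xs"
        unfolding occ_def by blast
      then have "m = ?r + monomial is \<beta>"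
        using * by (metis subset_mset.add_diff_inverse)
      then show ?thesis
        unfolding occ_def using "is" x by (intro exI[of _ "x # is"]) (auto simp: mon)
    qed
  qed
  moreover have "\<not> (occ xs (b # \<beta>) m \<and> ?r \<subseteq># m)"
  proof
    assume *: "occ xs (b # \<beta>) m \<and> ?r \<subseteq># m"
    then obtain "is" where "length is = length (b # \<beta>)" "m = monomial is (b # \<beta>)" "set is \<subseteq> set xs"
      unfolding occ_def by blast
    then have "set_mset m \<subseteq> set xs"
      using "3.prems" set_mset_monomial by metis
    moreover have "x \<in># m"
      using * b by (auto dest!: set_mset_mono)
    ultimately show False
      using x by blast
  qed
  moreover have "mcoeff (M_in xs (b # \<beta>)) m = (if occ xs (b # \<beta>) m then 1 else 0)"
    "mcoeff (M_in xs \<beta>) m = (if occ xs \<beta> m then 1 else 0)" for m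
    using "3.IH" "3.prems" \<beta> by (simp_all add: occ_def)
  ultimately show ?case
    unfolding occ_def[symmetric] M_in.simps plus_mpser.rep_eq mcoeff_monom_ser_mult by auto
qed

text \<open>Since the parts are positive, the index sequence of a monomial lists exactly its
  variables, so restricting the indices to \<open>xs\<close> excludes nothing here.\<close>

lemma mcoeff_M_eq_M_in:
  assumes "sorted_wrt (<) xs" "composition \<beta>" "set_mset m \<subseteq> set xs"
  shows "mcoeff (M \<beta>) m = mcoeff (M_in xs \<beta>) m"
proof -
  have "(\<exists>is. sorted_wrt (<) is \<and> length is = length \<beta> \<and> m = monomial is \<beta> \<and> set is \<subseteq> set xs)
    \<longleftrightarrow> (\<exists>is. sorted_wrt (<) is \<and> length is = length \<beta> \<and> m = monomial is \<beta>)"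
    using assms set_mset_monomial by metis
  then show ?thesis
    using assms by (simp add: mcoeff_M_in M.rep_eq)
qed

section \<open>Sums over cuts into nonempty blocks\<close>

definition cuts :: "'a list \<Rightarrow> 'a list list set" where
  "cuts \<alpha> = {bs. concat bs = \<alpha> \<and> [] \<notin> set bs}"

lemma cuts_Nil [simp]: "cuts [] = {[]}"
proof -
  have "bs = []" if "concat bs = []" "[] \<notin> set bs" for bs :: "'a list list"
    using that by (cases bs) auto
  then show ?thesis
    by (auto simp: cuts_def)
qed

lemma finite_cuts: "finite (cuts \<alpha>)"
proof (rule finite_subset)
  let ?B = "{b. set b \<subseteq> set \<alpha> \<and> length b \<le> length \<alpha>}"
  have "length b \<le> length (concat bs)" if "b \<in> set bs" for b and bs :: "'a list list"
    using that by (auto simp: length_concat member_le_sum_list)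
  moreover have "length bs \<le> length (concat bs)" if "[] \<notin> set bs" for bs :: "'a list list"
    using that
  proof (induction bs)
    case (Cons b bs)
    then show ?case by (cases b) auto
  qed simp
  ultimately show "cuts \<alpha> \<subseteq> {bs. set bs \<subseteq> ?B \<and> length bs \<le> length \<alpha>}"
    by (auto simp: cuts_def)
qed (simp add: finite_lists_length_le)

text \<open>Cuts are sorted by their first block; \<open>i\<close> counts its letters after
  \<open>a\<close>, so that \<open>i = 0\<close> already gives a nonempty block.\<close>

lemma sum_cuts_Cons:
  "sum F (cuts (a # \<alpha>)) = (\<Sum>i\<le>length \<alpha>. \<Sum>bs\<in>cuts (drop i \<alpha>). F ((a # take i \<alpha>) # bs))"
proof -
  have "sum F (cuts (a # \<alpha>)) =
      (\<Sum>(i, bs)\<in>(SIGMA i:{..length \<alpha>}. cuts (drop i \<alpha>)). F ((a # take i \<alpha>) # bs))"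
  proof (rule sum.reindex_bij_witness[of _ "\<lambda>(i, bs). (a # take i \<alpha>) # bs"
        "\<lambda>bs. (length (hd bs) - 1, tl bs)"])
    fix bs assume bs: "bs \<in> cuts (a # \<alpha>)"
    then obtain b bs' where [simp]: "bs = (a # b) # bs'" "\<alpha> = b @ concat bs'" and "[] \<notin> set bs'"
      by (cases bs; cases "hd bs") (auto simp: cuts_def)
    then show "(case (length (hd bs) - 1, tl bs) of (i, bs) \<Rightarrow> (a # take i \<alpha>) # bs) = bs"
      "(length (hd bs) - 1, tl bs) \<in> (SIGMA i:{..length \<alpha>}. cuts (drop i \<alpha>))"
      "(case (length (hd bs) - 1, tl bs) of (i, bs) \<Rightarrow> F ((a # take i \<alpha>) # bs)) = F bs"
      by (auto simp: cuts_def)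
  qed (auto simp: cuts_def)
  then show ?thesis
    by (simp add: sum.Sigma finite_cuts)
qed

text \<open>For \<open>F = M\<close> this is the normalized powersum. Keeping \<open>F\<close>
  variable allows passing to \<open>M_in xs\<close>; cuts with a block that is not weakly decreasing
  have weight 0.\<close>

definition cuts_sum :: "(nat list \<Rightarrow> mpser) \<Rightarrow> nat list \<Rightarrow> mpser" where
  "cuts_sum F \<alpha> = (\<Sum>bs\<in>cuts \<alpha>. scale (\<Prod>b\<leftarrow>bs. desc_weight b) (F (map sum_list bs)))"

text \<open>The value of \<open>cuts_sum (M_in [x])\<close>: with one variable, only cuts into at
  most one block survive.\<close>

definition one_var :: "nat \<Rightarrow> nat list \<Rightarrow> mpser" where
  "one_var x w = scale (desc_weight w) (monom_ser (replicate_mset (sum_list w) x))"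

text \<open>All shuffles have the same sum, so the power of \<open>x\<close> is a common factor and
  \<open>shuffle_character_desc_weight\<close> remains.\<close>

lemma shuffle_character_one_var: "shuffle_character (one_var x)"
  unfolding shuffle_character_def
proof (intro allI)
  fix u v :: "nat list"
  have sum: "sum_list w = sum_list u + sum_list v" if "w \<in># shuffle_mset u v" for w
    using arg_cong[OF mset_shuffle[OF that], of sum_mset] by (simp add: sum_mset_sum_list)
  have rep: "replicate_mset (sum_list u + sum_list v) x
      = replicate_mset (sum_list u) x + replicate_mset (sum_list v) x"
    by (simp add: multiset_eq_iff)
  have "(\<Sum>w\<in>#shuffle_mset u v. one_var x w) = (\<Sum>w\<in>#shuffle_mset u v.
      scale (desc_weight w) (monom_ser (replicate_mset (sum_list u + sum_list v) x)))"
    by (rule arg_cong[of _ _ sum_mset], rule image_mset_cong) (simp add: one_var_def sum)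
  also have "\<dots> = one_var x u * one_var x v"
    using shuffle_character_desc_weight
    by (simp add: sum_mset_scale one_var_def scale_times_scale shuffle_character_def
        rep monom_ser_add)
  finally show "one_var x u * one_var x v = (\<Sum>w\<in>#shuffle_mset u v. one_var x w)" ..
qed

text \<open>The prefix \<open>u\<close> is the block carried by \<open>x\<close>: an empty prefix
  gives the terms in which \<open>x\<close> does not occur, a nonempty one is the first block of the
  cut. These are the two summands in the recursion of \<open>M_in\<close>.\<close>

lemma cuts_sum_M_in_Cons:
  "cuts_sum (M_in (x # xs)) \<alpha> = deconc_sum (\<lambda>u v. one_var x u * cuts_sum (M_in xs) v) \<alpha>"
proof (cases \<alpha>)
  case Nil
  then show ?thesis
    by (simp add: cuts_sum_def one_var_def scale_one)
next
  case (Cons a \<alpha>')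
  have one: "one_var x [] = 1"
    by (simp add: one_var_def scale_one)
  have mult: "scale (c * d) (f * g) = scale c f * scale d g" for c d f g
    by (simp add: scale_times_scale)
  show ?thesis
    unfolding Cons deconc_sum_Cons one
    unfolding deconc_sum_def cuts_sum_def sum_cuts_Cons one_var_def
    by (simp add: scale_add_right sum.distrib mult sum_distrib_left)
qed

lemma shuffle_character_cuts_sum_M_in: "shuffle_character (cuts_sum (M_in xs))"
proof (induction xs)
  case Nil
  have "cuts_sum (M_in []) w = (if w = [] then 1 else 0)" for w
    by (cases w) (simp_all add: cuts_sum_def sum_cuts_Cons scale_one)
  then have "cuts_sum (M_in []) = (\<lambda>w. if w = [] then 1 else 0)"
    by blast
  then show ?case
    using shuffle_character_counit by metis
next
  case (Cons x xs)
  have "cuts_sum (M_in (x # xs)) = deconc_sum (\<lambda>u v. one_var x u * cuts_sum (M_in xs) v)"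
    using cuts_sum_M_in_Cons by blast
  then show ?case
    using shuffle_character_conv[OF shuffle_character_one_var Cons] by metis
qed

lemma composition_map_sum_list_cuts:
  "composition \<alpha> \<Longrightarrow> bs \<in> cuts \<alpha> \<Longrightarrow> composition (map sum_list bs)"
  by (rule refines_composition[of \<alpha>]) (auto simp: cuts_def refines_def grouping_def)

lemma mcoeff_cuts_sum_M:
  assumes "sorted_wrt (<) xs" "composition \<alpha>" "set_mset m \<subseteq> set xs"
  shows "mcoeff (cuts_sum M \<alpha>) m = mcoeff (cuts_sum (M_in xs) \<alpha>) m"
  unfolding cuts_sum_def mcoeff_sum mcoeff_scale
  by (rule sum.cong)
    (simp_all add: mcoeff_M_eq_M_in[OF assms(1) composition_map_sum_list_cuts[OF assms(2)] assms(3)])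

lemma composition_shuffle:
  "composition \<alpha> \<Longrightarrow> composition \<beta> \<Longrightarrow> \<gamma> \<in># shuffle_mset \<alpha> \<beta> \<Longrightarrow> composition \<gamma>"
  unfolding composition_def by (drule mset_shuffle) (metis Un_iff set_mset_mset set_mset_union)

lemma cuts_sum_M_mult:
  assumes "composition \<alpha>" "composition \<beta>"
  shows "cuts_sum M \<alpha> * cuts_sum M \<beta> = (\<Sum>\<gamma>\<in>#shuffle_mset \<alpha> \<beta>. cuts_sum M \<gamma>)"
proof (rule mpser_eqI)
  fix m :: "nat multiset"
  \<comment> \<open>The coefficient at \<open>m\<close> of the product involves only divisors of
    \<open>m\<close>, so the variables of \<open>m\<close> suffice and \<open>M\<close> may be
    replaced by \<open>M_in xs\<close>.\<close>
  define xs where "xs = sorted_list_of_set (set_mset m)"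
  have xs: "sorted_wrt (<) xs" "set xs = set_mset m"
    by (simp_all add: xs_def)
  have "mcoeff (cuts_sum M \<alpha> * cuts_sum M \<beta>) m
      = mcoeff (cuts_sum (M_in xs) \<alpha> * cuts_sum (M_in xs) \<beta>) m"
    unfolding times_mpser.rep_eq
  proof (rule sum.cong[OF refl], clarify)
    fix a b assume "m = a + b"
    then show "mcoeff (cuts_sum M \<alpha>) a * mcoeff (cuts_sum M \<beta>) b
        = mcoeff (cuts_sum (M_in xs) \<alpha>) a * mcoeff (cuts_sum (M_in xs) \<beta>) b"
      using mcoeff_cuts_sum_M[OF xs(1)] assms xs(2) by simp
  qed
  also have "\<dots> = (\<Sum>\<gamma>\<in>#shuffle_mset \<alpha> \<beta>. mcoeff (cuts_sum (M_in xs) \<gamma>) m)"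
    using shuffle_character_cuts_sum_M_in[of xs]
    by (simp add: shuffle_character_def mcoeff_sum_mset)
  also have "\<dots> = (\<Sum>\<gamma>\<in>#shuffle_mset \<alpha> \<beta>. mcoeff (cuts_sum M \<gamma>) m)"
    by (rule arg_cong[of _ _ sum_mset], rule image_mset_cong)
      (metis mcoeff_cuts_sum_M composition_shuffle assms xs order.refl)
  finally show "mcoeff (cuts_sum M \<alpha> * cuts_sum M \<beta>) m
      = mcoeff (\<Sum>\<gamma>\<in>#shuffle_mset \<alpha> \<beta>. cuts_sum M \<gamma>) m"
    by (simp add: mcoeff_sum_mset)
qed

section \<open>Descending runs and cuts into weakly decreasing blocks\<close>

lemma descending_runs_eq_Nil_iff [simp]: "descending_runs as = [] \<longleftrightarrow> as = []"
  by (induction as rule: descending_runs.induct) (auto simp: Let_def)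

lemma concat_descending_runs [simp]: "concat (descending_runs as) = as"
proof (induction as rule: descending_runs.induct)
  case (3 a b as)
  then show ?case
    by (cases "descending_runs (b # as)") (auto simp: Let_def)
qed simp_all

lemma Nil_notin_descending_runs: "[] \<notin> set (descending_runs as)"
proof (induction as rule: descending_runs.induct)
  case (3 a b as)
  then show ?case
    by (cases "descending_runs (b # as)") (auto simp: Let_def)
qed simp_all

lemma sorted_descending_runs: "r \<in> set (descending_runs as) \<Longrightarrow> sorted_wrt (\<ge>) r"
proof (induction as arbitrary: r rule: descending_runs.induct)
  case (3 a b as)
  obtain r' rs where rs: "descending_runs (b # as) = r' # rs"
    by (cases "descending_runs (b # as)") (auto dest: arg_cong[of _ _ "\<lambda>x. x = []"])
  then have "r' \<noteq> []"
    using Nil_notin_descending_runs[of "b # as"] by auto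
  moreover have "concat (descending_runs (b # as)) = b # as"
    by (rule concat_descending_runs)
  ultimately obtain r'' where "r' = b # r''"
    using rs by (cases r') auto
  then show ?case
    using 3 rs by (fastforce simp: Let_def split: if_splits)
qed simp_all

lemma descending_runs_append:
  assumes "b \<noteq> []" "sorted_wrt (\<ge>) b" "as \<noteq> []"
  shows "descending_runs (b @ as) =
    (if last b < hd as then b # descending_runs as
     else (b @ hd (descending_runs as)) # tl (descending_runs as))"
  using assms
proof (induction b rule: induct_list012)
  case (2 x)
  then show ?case
    by (cases as) (auto simp: Let_def)
next
  case (3 x y zs)
  then show ?case by (auto simp: Let_def)
qed simp

lemma descending_runs_sorted: "b \<noteq> [] \<Longrightarrow> sorted_wrt (\<ge>) b \<Longrightarrow> descending_runs b = [b]"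
  by (induction b rule: induct_list012) (auto simp: Let_def)

text \<open>A weakly decreasing block cannot straddle a strict ascent, so every run is a union of
  consecutive blocks, collected in one entry of \<open>bss\<close>. A block put in front opens a new
  group at an ascent and joins the first group otherwise.\<close>

lemma sorted_cuts_refine_runs:
  assumes "[] \<notin> set bs" "\<forall>b\<in>set bs. sorted_wrt (\<ge>) b"
  shows "\<exists>bss. concat bss = bs \<and> [] \<notin> set bss \<and> map concat bss = descending_runs (concat bs)"
  using assms
proof (induction bs)
  case Nil
  show ?case by (rule exI[of _ "[]"]) simp
next
  case (Cons b bs)
  then obtain bss where bss: "concat bss = bs" "[] \<notin> set bss"
    "map concat bss = descending_runs (concat bs)"
    by auto
  have b: "b \<noteq> []" "sorted_wrt (\<ge>) b"
    using Cons.prems by auto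
  show ?case
  proof (cases "concat bs = []")
    case True
    then have "bs = []"
      using Cons.prems by (cases bs) auto
    then show ?thesis
      using b by (intro exI[of _ "[[b]]"]) (simp add: descending_runs_sorted)
  next
    case False
    then obtain c css where css: "bss = c # css"
      using bss by (cases bss) auto
    show ?thesis
    proof (cases "last b < hd (concat bs)")
      case True
      then show ?thesis
        using bss b False by (intro exI[of _ "[b] # bss"]) (simp add: descending_runs_append)
    next
      case notless: False
      have "descending_runs (concat bs) = concat c # map concat css"
        using bss css by simp
      then show ?thesis
        using bss b False notless css
        by (intro exI[of _ "(b # c) # css"]) (simp add: descending_runs_append)
    qed
  qed
qed

text \<open>Lifts a grouping of block sums to a grouping of the blocks themselves.\<close>

lemma concat_eq_map_unfold:
  "concat cs = map f bs \<Longrightarrow> \<exists>bss. concat bss = bs \<and> map (map f) bss = cs"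
proof (induction cs arbitrary: bs)
  case (Cons c cs)
  then obtain b bs' where "bs = b @ bs'" "map f b = c" "map f bs' = concat cs"
    by (metis append_eq_map_conv concat.simps(2))
  moreover from this obtain bss where "concat bss = bs'" "map (map f) bss = cs"
    using Cons.IH by metis
  ultimately show ?case
    by (intro exI[of _ "b # bss"]) simp
qed simp

lemma concat_map_concat: "concat (map concat xsss) = concat (concat xsss)"
  by (induction xsss) simp_all

lemma sum_list_map_sum_list: "sum_list (map sum_list xss) = sum_list (concat xss)"
  by (induction xss) simp_all

text \<open>Forwards, a grouping of the block sums lifts to a grouping of \<open>\<alpha>\<close>
  with sums \<open>C_comp \<alpha>\<close>. As parts are positive it is unique, so its groups are
  the descending runs, and each block lies inside a run. Backwards,
  \<open>sorted_cuts_refine_runs\<close> supplies the grouping.\<close>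

lemma refines_C_comp_iff:
  assumes \<alpha>: "composition \<alpha>" and bs: "bs \<in> cuts \<alpha>"
  shows "refines (map sum_list bs) (C_comp \<alpha>) \<longleftrightarrow> (\<forall>b\<in>set bs. sorted_wrt (\<ge>) b)"
proof
  assume "refines (map sum_list bs) (C_comp \<alpha>)"
  then obtain cs where cs: "concat cs = map sum_list bs" "[] \<notin> set cs" "map sum_list cs = C_comp \<alpha>"
    by (auto simp: refines_def grouping_def)
  obtain bss where bss: "concat bss = bs" "map (map sum_list) bss = cs"
    using concat_eq_map_unfold[OF cs(1)] by blast
  have "concat xs \<noteq> []" if "xs \<in> set bss" for xs
  proof -
    have "map sum_list xs \<in> set cs"
      using that bss(2) by auto
    then have "xs \<noteq> []"
      using cs(2) by auto
    moreover have "[] \<notin> set xs"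
      using bs bss(1) that by (auto simp: cuts_def)
    ultimately show ?thesis
      by (cases xs) auto
  qed
  then have "[] \<notin> set (map concat bss)"
    by (metis image_iff set_map)
  moreover have "concat (map concat bss) = \<alpha>"
    using bss(1) bs by (simp add: cuts_def concat_map_concat)
  moreover have "map sum_list (map concat bss) = C_comp \<alpha>"
    using cs(3) unfolding bss(2)[symmetric] by (simp add: comp_def sum_list_map_sum_list)
  ultimately have "grouping \<alpha> (C_comp \<alpha>) (map concat bss)"
    by (simp add: grouping_def)
  moreover have "grouping \<alpha> (C_comp \<alpha>) (descending_runs \<alpha>)"
    by (simp add: grouping_def C_comp_def Nil_notin_descending_runs)
  ultimately have runs: "map concat bss = descending_runs \<alpha>"
    using \<alpha> grouping_unique by blast
  show "\<forall>b\<in>set bs. sorted_wrt (\<ge>) b"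
  proof
    fix b assume "b \<in> set bs"
    then obtain xs where xs: "xs \<in> set bss" "b \<in> set xs"
      unfolding bss(1)[symmetric] by auto
    have "concat xs \<in> set (descending_runs \<alpha>)"
      unfolding runs[symmetric] using xs(1) by simp
    then have "sorted_wrt (\<ge>) (concat xs)"
      by (rule sorted_descending_runs)
    then show "sorted_wrt (\<ge>) b"
      using split_list[OF xs(2)] by (auto simp: sorted_wrt_append)
  qed
next
  assume "\<forall>b\<in>set bs. sorted_wrt (\<ge>) b"
  then obtain bss where bss: "concat bss = bs" "[] \<notin> set bss"
      "map concat bss = descending_runs \<alpha>"
    using sorted_cuts_refine_runs[of bs] bs by (auto simp: cuts_def)
  have "grouping (map sum_list bs) (C_comp \<alpha>) (map (map sum_list) bss)"
    using bss(2) unfolding grouping_def C_comp_def bss(3)[symmetric] bss(1)[symmetric]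
    by (auto simp: map_concat sum_list_map_sum_list)
  then show "refines (map sum_list bs) (C_comp \<alpha>)"
    unfolding refines_def by blast
qed

section \<open>Powersums as sums over cuts\<close>

text \<open>Uniqueness of groupings recovers \<open>bs\<close> from its sums. Factors for
  \<open>i\<close> outside \<open>set \<alpha>\<close> are 1, so the products over \<open>i\<close>
  and over the blocks are finite and can be exchanged.\<close>

lemma C_coeff_cuts:
  assumes \<alpha>: "composition \<alpha>" and bs: "bs \<in> cuts \<alpha>"
  shows "C_coeff \<alpha> (map sum_list bs) = mult_fact \<alpha> / (\<Prod>b\<leftarrow>bs. mult_fact b)"
proof -
  have swap: "(\<Prod>i\<in>set \<alpha>. \<Prod>b\<leftarrow>cs. fact (count_list b i)) = (\<Prod>b\<leftarrow>cs. mult_fact b)"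
    if "\<forall>b\<in>set cs. set b \<subseteq> set \<alpha>" for cs
    using that by (induction cs) (simp_all add: prod.distrib mult_fact_superset[of "set \<alpha>"])
  have "groups \<alpha> (map sum_list bs) = bs"
    using bs by (intro groups_eqI \<alpha>) (simp add: grouping_def cuts_def)
  then have "C_coeff \<alpha> (map sum_list bs)
      = (\<Prod>i. fact (count_list \<alpha> i) / (\<Prod>b\<leftarrow>bs. fact (count_list b i)))"
    by (simp add: C_coeff_def)
  also have "\<dots> = (\<Prod>i\<in>set \<alpha>. fact (count_list \<alpha> i) / (\<Prod>b\<leftarrow>bs. fact (count_list b i)))"
  proof (rule Prod_any.expand_superset)
    have "fact (count_list \<alpha> i) / (\<Prod>b\<leftarrow>bs. fact (count_list b i)) = (1 :: rat)" if "i \<notin> set \<alpha>" for i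
    proof -
      have "map (\<lambda>b. fact (count_list b i)) bs = map (\<lambda>b. 1 :: rat) bs"
        using that bs by (auto simp: cuts_def count_list_eq_0)
      then show ?thesis
        using that by (simp add: count_list_eq_0 map_replicate_const)
    qed
    then show "{i. fact (count_list \<alpha> i) / (\<Prod>b\<leftarrow>bs. fact (count_list b i)) \<noteq> (1 :: rat)} \<subseteq> set \<alpha>"
      by blast
  qed simp
  also have "\<dots> = mult_fact \<alpha> / (\<Prod>i\<in>set \<alpha>. \<Prod>b\<leftarrow>bs. fact (count_list b i))"
    by (simp add: prod_dividef mult_fact_superset[of "set \<alpha>"])
  also have "(\<Prod>i\<in>set \<alpha>. \<Prod>b\<leftarrow>bs. fact (count_list b i)) = (\<Prod>b\<leftarrow>bs. mult_fact b)"
    by (rule swap) (use bs in \<open>auto simp: cuts_def\<close>)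
  finally show ?thesis .
qed

text \<open>\<open>groups \<alpha>\<close> and \<open>map sum_list\<close> are mutually inverse
  between the compositions indexing \<open>P \<alpha>\<close> and the cuts into weakly decreasing
  blocks; all other cuts add 0.\<close>

lemma P_eq_cuts_sum:
  assumes \<alpha>: "composition \<alpha>"
  shows "P \<alpha> = scale (mult_fact \<alpha>) (cuts_sum M \<alpha>)"
proof -
  let ?S = "{bs \<in> cuts \<alpha>. \<forall>b\<in>set bs. sorted_wrt (\<ge>) b}"
  have "P \<alpha> = (\<Sum>bs\<in>?S. scale (C_coeff \<alpha> (map sum_list bs)) (M (map sum_list bs)))"
    unfolding P_def
  proof (rule sum.reindex_bij_witness[of _ "map sum_list" "groups \<alpha>"])
    fix \<beta> assume "\<beta> \<in> {\<beta>. refines \<alpha> \<beta> \<and> refines \<beta> (C_comp \<alpha>)}"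
    then have "grouping \<alpha> \<beta> (groups \<alpha> \<beta>)" and ref: "refines \<beta> (C_comp \<alpha>)"
      using grouping_groups[OF \<alpha>] by auto
    then show \<beta>: "map sum_list (groups \<alpha> \<beta>) = \<beta>"
      and "scale (C_coeff \<alpha> (map sum_list (groups \<alpha> \<beta>))) (M (map sum_list (groups \<alpha> \<beta>)))
        = scale (C_coeff \<alpha> \<beta>) (M \<beta>)"
      and "groups \<alpha> \<beta> \<in> ?S"
      using refines_C_comp_iff[OF \<alpha>, of "groups \<alpha> \<beta>"] by (auto simp: grouping_def cuts_def)
  next
    fix bs assume bs: "bs \<in> ?S"
    then have g: "grouping \<alpha> (map sum_list bs) bs"
      by (simp add: grouping_def cuts_def)
    then show "groups \<alpha> (map sum_list bs) = bs"
      by (rule groups_eqI[OF \<alpha>])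
    show "map sum_list bs \<in> {\<beta>. refines \<alpha> \<beta> \<and> refines \<beta> (C_comp \<alpha>)}"
      using g bs refines_C_comp_iff[OF \<alpha>] by (auto simp: refines_def)
  qed
  also have "\<dots> = (\<Sum>bs\<in>?S. scale (mult_fact \<alpha> * (\<Prod>b\<leftarrow>bs. desc_weight b)) (M (map sum_list bs)))"
  proof (rule sum.cong[OF refl])
    fix bs assume bs: "bs \<in> ?S"
    have "(\<Prod>b\<leftarrow>cs. desc_weight b) = 1 / (\<Prod>b\<leftarrow>cs. mult_fact b)"
      if "\<forall>b\<in>set cs. sorted_wrt (\<ge>) b" for cs
      using that by (induction cs) (simp_all add: desc_weight_def)
    with bs show "scale (C_coeff \<alpha> (map sum_list bs)) (M (map sum_list bs))
        = scale (mult_fact \<alpha> * (\<Prod>b\<leftarrow>bs. desc_weight b)) (M (map sum_list bs))"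
      using C_coeff_cuts[OF \<alpha>, of bs] by simp
  qed
  also have "\<dots> = (\<Sum>bs\<in>cuts \<alpha>.
      scale (mult_fact \<alpha> * (\<Prod>b\<leftarrow>bs. desc_weight b)) (M (map sum_list bs)))"
  proof (rule sum.mono_neutral_left[OF finite_cuts])
    show "\<forall>bs\<in>cuts \<alpha> - ?S.
        scale (mult_fact \<alpha> * (\<Prod>b\<leftarrow>bs. desc_weight b)) (M (map sum_list bs)) = 0"
    proof
      fix bs assume "bs \<in> cuts \<alpha> - ?S"
      then obtain b where "b \<in> set bs" "\<not> sorted_wrt (\<ge>) b"
        by blast
      then have "0 \<in> set (map desc_weight bs)"
        by (force simp: desc_weight_def)
      then have "(\<Prod>b\<leftarrow>bs. desc_weight b) = 0"
        by (simp only: prod_list_zero_iff)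
      then show "scale (mult_fact \<alpha> * (\<Prod>b\<leftarrow>bs. desc_weight b)) (M (map sum_list bs)) = 0"
        by simp
    qed
  qed auto
  finally show ?thesis
    by (simp add: cuts_sum_def scale_sum scale_scale)
qed

theorem theorem3:
  fixes \<alpha> \<beta> :: "nat list"
  assumes "composition \<alpha>" and "composition \<beta>"
  shows "P \<alpha> * P \<beta> =
    (\<Sum>\<gamma>\<in>#shuffle_mset \<alpha> \<beta>.
       scale (\<Prod>i. fact (count_list \<alpha> i) * fact (count_list \<beta> i) / fact (count_list \<gamma> i)) (P \<gamma>))"
proof -
  have coeff: "(\<Prod>i. fact (count_list \<alpha> i) * fact (count_list \<beta> i) / fact (count_list \<gamma> i))
      = mult_fact \<alpha> * mult_fact \<beta> / mult_fact \<gamma>" for \<gamma>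
  proof -
    \<comment> \<open>A common finite index set for all the unrestricted products, on which the
      quotient can be split.\<close>
    let ?A = "set \<alpha> \<union> set \<beta> \<union> set \<gamma>"
    have "(\<Prod>i. fact (count_list \<alpha> i) * fact (count_list \<beta> i) / fact (count_list \<gamma> i))
      = (\<Prod>i\<in>?A. fact (count_list \<alpha> i) * fact (count_list \<beta> i) / fact (count_list \<gamma> i) :: rat)"
      by (rule Prod_any.expand_superset) (auto intro: ccontr simp: count_list_eq_0)
    moreover have "mult_fact \<alpha> = (\<Prod>i\<in>?A. fact (count_list \<alpha> i))"
      "mult_fact \<beta> = (\<Prod>i\<in>?A. fact (count_list \<beta> i))"
      "mult_fact \<gamma> = (\<Prod>i\<in>?A. fact (count_list \<gamma> i))"
      by (rule mult_fact_superset; auto)+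
    ultimately show ?thesis
      by (simp add: prod_dividef prod.distrib)
  qed
  have "P \<alpha> * P \<beta> = scale (mult_fact \<alpha> * mult_fact \<beta>) (\<Sum>\<gamma>\<in>#shuffle_mset \<alpha> \<beta>. cuts_sum M \<gamma>)"
    using assms by (simp add: P_eq_cuts_sum scale_times_scale cuts_sum_M_mult)
  also have "\<dots> = (\<Sum>\<gamma>\<in>#shuffle_mset \<alpha> \<beta>.
      scale (mult_fact \<alpha> * mult_fact \<beta>) (cuts_sum M \<gamma>))"
    by (rule scale_sum_mset)
  also have "\<dots> = (\<Sum>\<gamma>\<in>#shuffle_mset \<alpha> \<beta>.
      scale (mult_fact \<alpha> * mult_fact \<beta> / mult_fact \<gamma>) (P \<gamma>))"
    by (rule arg_cong[of _ _ sum_mset], rule image_mset_cong)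
      (simp add: P_eq_cuts_sum composition_shuffle[OF assms] scale_scale)
  finally show ?thesis
    by (simp only: coeff)
qed

end
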